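(* Let $\mathcal{M}$ be a compact submanifold of $\mathbb{R}^p$ given by $\mathcal{M}=\{X\in\mathbb{R}^p:F(X)=0\}$, where $F:\mathbb{R}^p\to\mathbb{R}^q$ is a smooth mapping whose derivative $DF(X)$ at $X$ has full row rank for all $X\in\mathcal{M}$. Then, for any weakly convex function $h:\mathbb{R}^p\to\mathbb{R}$, there exists a constant $c>0$ such that $$h(Y)\ge h(X)+\big\langle\widetilde\nabla_{\mathcal R}h(X),\,Y-X\big\rangle-c\,\|Y-X\|_F^2$$ for all $X,Y\in\mathcal{M}$ and $\widetilde\nabla_{\mathcal R}h(X)\in\partial_{\mathcal R}h(X)$.
   Context: $\langle\cdot,\cdot\rangle$ and $\|\cdot\|_F$ denote the Euclidean inner product and norm on $\mathbb{R}^p$. A function $h:\mathbb{R}^p\to\mathbb{R}$ is weakly convex if for some $\tau\ge0$ the function $g:=h+\frac\tau2\|\cdot\|_F^2$ is convex; its Euclidean subdifferential is $\partial h(X)=\partial g(X)-\tau X$, where $\partial g$ is the convex subdifferential. $\mathcal{M}$ carries the Riemannian metric inherited from $\mathbb{R}^p$; its tangent space at $X$ is $T_X\mathcal{M}=\ker DF(X)$, and the Riemannian subdifferential of $h$ at $X\in\mathcal{M}$ is $\partial_{\mathcal R}h(X)=\mathcal{P}_{T_X\mathcal{M}}(\partial h(X))$, where $\mathcal{P}_{T_X\mathcal{M}}$ is the orthogonal projector onto $T_X\mathcal{M}$. *)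

theory Defs
  imports "HOL-Analysis.Analysis"
begin

primrec C_k :: "nat \<Rightarrow> ('a::euclidean_space \<Rightarrow> 'b::euclidean_space) \<Rightarrow> bool" where
  "C_k 0 f \<longleftrightarrow> continuous_on UNIV f"
| "C_k (Suc k) f \<longleftrightarrow>
     (\<forall>x. f differentiable (at x)) \<and> (\<forall>v. C_k k (\<lambda>x. frechet_derivative f (at x) v))"

definition smooth :: "('a::euclidean_space \<Rightarrow> 'b::euclidean_space) \<Rightarrow> bool" where
  "smooth f \<longleftrightarrow> (\<forall>k. C_k k f)"

definition shifted :: "real \<Rightarrow> ('a::euclidean_space \<Rightarrow> real) \<Rightarrow> 'a \<Rightarrow> real" where
  "shifted \<tau> h x = h x + \<tau> / 2 * (norm x)\<^sup>2"

definition weakly_convex :: "('a::euclidean_space \<Rightarrow> real) \<Rightarrow> bool" where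
  "weakly_convex h \<longleftrightarrow> (\<exists>\<tau>\<ge>0. convex_on UNIV (shifted \<tau> h))"

definition convex_subdifferential :: "('a::euclidean_space \<Rightarrow> real) \<Rightarrow> 'a \<Rightarrow> 'a set" where
  "convex_subdifferential g x = {v. \<forall>y. g y \<ge> g x + v \<bullet> (y - x)}"

(* The set does not depend on the modulus used to compute it; see subdifferential_eq below.
   The union over all admissible moduli avoids choosing one. *)
definition subdifferential :: "('a::euclidean_space \<Rightarrow> real) \<Rightarrow> 'a \<Rightarrow> 'a set" where
  "subdifferential h x =
     (\<Union>\<tau>\<in>{\<tau>. 0 \<le> \<tau> \<and> convex_on UNIV (shifted \<tau> h)}.
        (\<lambda>v. v - \<tau> *\<^sub>R x) ` convex_subdifferential (shifted \<tau> h) x)"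

definition orthogonal_projector :: "'a::euclidean_space set \<Rightarrow> 'a \<Rightarrow> 'a" where
  "orthogonal_projector T v = (THE w. w \<in> T \<and> v - w \<in> T\<^sup>\<bottom>)"

(* The tangent space of the zero set of F at one of its points. *)
definition tangent_space :: "('a::euclidean_space \<Rightarrow> 'b::euclidean_space) \<Rightarrow> 'a \<Rightarrow> 'a set" where
  "tangent_space F x = {v. frechet_derivative F (at x) v = 0}"

definition riemannian_subdifferential ::
  "('a::euclidean_space \<Rightarrow> 'b::euclidean_space) \<Rightarrow> ('a \<Rightarrow> real) \<Rightarrow> 'a \<Rightarrow> 'a set" where
  "riemannian_subdifferential F h x = orthogonal_projector (tangent_space F x) ` subdifferential h x"

lemma orthogonal_projector_unique:
  assumes "subspace T" "w \<in> T" "v - w \<in> T\<^sup>\<bottom>"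
  shows "orthogonal_projector T v = w"
  unfolding orthogonal_projector_def
proof (rule the_equality)
  fix u assume u: "u \<in> T \<and> v - u \<in> T\<^sup>\<bottom>"
  have "u - w \<in> T"
    using assms u by (simp add: subspace_diff)
  then have "(u - w) \<bullet> (v - w) = 0" "(u - w) \<bullet> (v - u) = 0"
    using assms u by (auto simp: orthogonal_comp_def orthogonal_def)
  then have "(u - w) \<bullet> (u - w) = 0"
    by (simp add: inner_diff_right)
  then show "u = w" by simp
qed (use assms in auto)

lemma orthogonal_projector:
  assumes "subspace T"
  shows "orthogonal_projector T v \<in> T" "v - orthogonal_projector T v \<in> T\<^sup>\<bottom>"
proof -
  obtain y z where yz: "y \<in> span T" "\<And>w. w \<in> span T \<Longrightarrow> orthogonal z w" "v = y + z"
    using orthogonal_subspace_decomp_exists[of T v] by metis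
  have y: "y \<in> T" and z: "v - y \<in> T\<^sup>\<bottom>"
    using yz assms
    by (auto simp: span_eq_iff[THEN iffD2] orthogonal_comp_def orthogonal_commute)
  then have "orthogonal_projector T v = y"
    using assms orthogonal_projector_unique by blast
  with y z show "orthogonal_projector T v \<in> T" "v - orthogonal_projector T v \<in> T\<^sup>\<bottom>"
    by auto
qed

lemma subdifferential_eq:
  assumes "0 \<le> \<tau>" "convex_on UNIV (shifted \<tau> h)"
  shows "subdifferential h x = (\<lambda>v. v - \<tau> *\<^sub>R x) ` convex_subdifferential (shifted \<tau> h) x"
    (is "_ = ?R")
proof
  show "?R \<subseteq> subdifferential h x"
    using assms unfolding subdifferential_def by blast
next
  have sq: "(norm y)\<^sup>2 = (norm x)\<^sup>2 + 2 * (x \<bullet> (y - x)) + (norm (y - x))\<^sup>2" for y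
    by (simp add: power2_norm_eq_inner inner_diff inner_commute algebra_simps)
  show "subdifferential h x \<subseteq> ?R"
  proof
    fix w assume "w \<in> subdifferential h x"
    then obtain \<sigma> v where v: "v \<in> convex_subdifferential (shifted \<sigma> h) x" "w = v - \<sigma> *\<^sub>R x"
      unfolding subdifferential_def by blast
    have "0 \<le> shifted \<tau> h y - shifted \<tau> h x - (w + \<tau> *\<^sub>R x) \<bullet> (y - x)" (is "0 \<le> ?D") for y
    proof -
      define K where "K = \<bar>\<sigma> - \<tau>\<bar> / 2 * (norm (y - x))\<^sup>2"
      have D: "- (t * K) \<le> ?D" if t: "0 < t" "t < 1" for t
      proof -
        define z where "z = x + t *\<^sub>R (y - x)"
        have zx: "z - x = t *\<^sub>R (y - x)" by (simp add: z_def)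
        have "shifted \<tau> h z \<le> (1 - t) * shifted \<tau> h x + t * shifted \<tau> h y"
          using convex_onD[OF assms(2), of t x y] t by (simp add: z_def algebra_simps)
        moreover have "shifted \<sigma> h x + v \<bullet> (z - x) \<le> shifted \<sigma> h z"
          using v(1) unfolding convex_subdifferential_def by blast
        moreover have "shifted \<tau> h z - shifted \<tau> h x - (w + \<tau> *\<^sub>R x) \<bullet> (z - x)
            = shifted \<sigma> h z - shifted \<sigma> h x - v \<bullet> (z - x) - (\<sigma> - \<tau>) / 2 * (norm (z - x))\<^sup>2"
          unfolding shifted_def v(2) sq[of z]
          by (simp add: inner_add_left inner_diff_left field_simps)
        moreover have "(\<sigma> - \<tau>) / 2 * (norm (z - x))\<^sup>2 \<le> t\<^sup>2 * K"
        proof -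
          have "(\<sigma> - \<tau>) / 2 * (norm (z - x))\<^sup>2 \<le> \<bar>\<sigma> - \<tau>\<bar> / 2 * (norm (z - x))\<^sup>2"
            by (intro mult_right_mono divide_right_mono abs_ge_self) auto
          then show ?thesis
            by (simp add: zx K_def power_mult_distrib mult_ac)
        qed
        ultimately have "(w + \<tau> *\<^sub>R x) \<bullet> (z - x) - t\<^sup>2 * K
            \<le> (1 - t) * shifted \<tau> h x + t * shifted \<tau> h y - shifted \<tau> h x"
          by linarith
        then have "t * (- (t * K)) \<le> t * ?D"
          by (simp add: zx algebra_simps power2_eq_square)
        then show ?thesis using t(1) mult_le_cancel_left_pos by blast
      qed
      have "((\<lambda>t. - (t * K)) \<longlongrightarrow> - (0 * K)) (at_right 0)"
        by (intro tendsto_intros)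
      moreover have "\<forall>\<^sub>F t in at_right 0. - (t * K) \<le> ?D"
        using D eventually_at_right_less[of "0::real"] eventually_at_rightI[of 0 1 "\<lambda>t::real. t < 1"]
        by (auto elim: eventually_elim2)
      ultimately have "- (0 * K) \<le> ?D"
        by (intro tendsto_upperbound) auto
      then show ?thesis by simp
    qed
    then have "w + \<tau> *\<^sub>R x \<in> convex_subdifferential (shifted \<tau> h) x"
      unfolding convex_subdifferential_def by (auto simp: algebra_simps)
    then show "w \<in> ?R"
      by (rule rev_image_eqI) simp
  qed
qed

end

theory Submission
  imports Defs
begin

text \<open>
  Let \<open>v\<close> be a Euclidean subgradient of \<open>h\<close> at \<open>X\<close> and \<open>G\<close> its tangential part. Weak convexity
  gives the claimed inequality with \<open>v\<close> in place of \<open>G\<close>, so only the error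
  \<open>(v - G) \<bullet> (Y - X)\<close> has to be controlled. The vector \<open>v - G\<close> is normal to the manifold at \<open>X\<close>,
  and a chord \<open>Y - X\<close> of the manifold is tangential up to second order; the error is therefore
  \<open>O(norm (Y - X)\<^sup>2)\<close>, and what remains is uniformity in \<open>X\<close> and \<open>Y\<close>.

  For the uniformity, write \<open>v - G = A\<^sup>T w\<close> with \<open>A = DF(X)\<close>, which is possible because normal vectors
  are those orthogonal to \<open>ker A\<close>. Then \<open>(v - G) \<bullet> (Y - X) = w \<bullet> A (Y - X)\<close>, and three constants
  bound this:
  subgradients of \<open>h\<close> over a compact set are bounded (\<open>subdifferential_bounded_on_compact\<close>);
  \<open>norm w\<close> is at most a constant times \<open>norm (A\<^sup>T w)\<close>, as \<open>A\<^sup>T\<close> is injective and depends continuously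
  on \<open>X\<close> in a compact set (\<open>adjoint_derivative_bounded_below\<close>); and since \<open>F X = F Y = 0\<close>, the
  vector \<open>A (Y - X)\<close> is the negative of a first-order Taylor remainder of \<open>F\<close>
  (\<open>taylor_remainder_quadratic\<close>).
\<close>

lemma weakly_convex_subgradient_inequality:
  assumes "0 \<le> \<tau>" "convex_on UNIV (shifted \<tau> h)" "v \<in> subdifferential h x"
  shows "h y \<ge> h x + v \<bullet> (y - x) - \<tau> / 2 * (norm (y - x))\<^sup>2"
proof -
  obtain u where u: "u \<in> convex_subdifferential (shifted \<tau> h) x" "v = u - \<tau> *\<^sub>R x"
    using assms by (auto simp: subdifferential_eq)
  then have "shifted \<tau> h y \<ge> shifted \<tau> h x + u \<bullet> (y - x)"
    by (simp add: convex_subdifferential_def)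
  moreover have "(norm y)\<^sup>2 = (norm x)\<^sup>2 + 2 * (x \<bullet> (y - x)) + (norm (y - x))\<^sup>2"
    by (simp add: power2_norm_eq_inner inner_diff inner_commute algebra_simps)
  ultimately show ?thesis
    by (simp add: shifted_def u(2) inner_diff_left algebra_simps add_divide_distrib)
qed

text \<open>
  A subgradient \<open>v\<close> of a convex function forces the function to rise by \<open>norm v\<close> along the unit step
  in the direction of \<open>v\<close>, and a finite convex function is continuous, hence bounded near a compact
  set.
\<close>

lemma convex_subdifferential_bounded_on_compact:
  fixes g :: "'a::euclidean_space \<Rightarrow> real"
  assumes "convex_on UNIV g" "compact K"
  obtains B where "\<And>x v. x \<in> K \<Longrightarrow> v \<in> convex_subdifferential g x \<Longrightarrow> norm v \<le> B"
proof -
  obtain r where r: "\<And>x. x \<in> K \<Longrightarrow> norm x \<le> r"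
    using assms(2) by (meson bounded_iff compact_imp_bounded)
  have "continuous_on UNIV g"
    using convex_on_continuous[OF open_UNIV assms(1)] .
  then have "compact (g ` cball 0 (r + 1))"
    by (metis compact_cball compact_continuous_image continuous_on_subset subset_UNIV)
  then obtain b where b: "\<And>x. norm x \<le> r + 1 \<Longrightarrow> \<bar>g x\<bar> \<le> b"
    using compact_imp_bounded[of "g ` cball 0 (r + 1)"] by (fastforce simp: bounded_iff)
  have "norm v \<le> 2 * b" if x: "x \<in> K" and v: "v \<in> convex_subdifferential g x" for x v
  proof -
    have "g (x + sgn v) \<ge> g x + v \<bullet> sgn v"
      using v[unfolded convex_subdifferential_def, simplified, rule_format, of "x + sgn v"] by simp
    moreover have "v \<bullet> sgn v = norm v"
      by (cases "v = 0") (simp_all add: sgn_div_norm power2_norm_eq_inner[symmetric] power2_eq_square)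
    moreover have "norm (x + sgn v) \<le> r + 1"
      using r[OF x] norm_triangle_ineq[of x "sgn v"] by (simp add: norm_sgn split: if_splits)
    moreover have "norm x \<le> r + 1"
      using r[OF x] by simp
    ultimately show ?thesis
      using b[of x] b[of "x + sgn v"] by linarith
  qed
  then show ?thesis
    using that by blast
qed

lemma subdifferential_bounded_on_compact:
  assumes "weakly_convex h" "compact K"
  obtains B where "B \<ge> 0" "\<And>x v. x \<in> K \<Longrightarrow> v \<in> subdifferential h x \<Longrightarrow> norm v \<le> B"
proof -
  obtain \<tau> where \<tau>: "0 \<le> \<tau>" "convex_on UNIV (shifted \<tau> h)"
    using assms(1) unfolding weakly_convex_def by blast
  obtain b where b: "\<And>x v. x \<in> K \<Longrightarrow> v \<in> convex_subdifferential (shifted \<tau> h) x \<Longrightarrow> norm v \<le> b"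
    using convex_subdifferential_bounded_on_compact[OF \<tau>(2) assms(2)] by blast
  obtain r where r: "\<And>x. x \<in> K \<Longrightarrow> norm x \<le> r"
    using assms(2) by (meson bounded_iff compact_imp_bounded)
  have "norm v \<le> \<bar>b\<bar> + \<tau> * \<bar>r\<bar>" if x: "x \<in> K" and v: "v \<in> subdifferential h x" for x v
  proof -
    obtain u where u: "u \<in> convex_subdifferential (shifted \<tau> h) x" "v = u - \<tau> *\<^sub>R x"
      using v \<tau> by (auto simp: subdifferential_eq)
    have "norm v \<le> norm u + \<tau> * norm x"
      using norm_triangle_ineq4[of u "\<tau> *\<^sub>R x"] \<tau> u by simp
    also have "\<dots> \<le> \<bar>b\<bar> + \<tau> * \<bar>r\<bar>"
      using b[OF x u(1)] r[OF x] \<tau>(1) by (intro add_mono mult_left_mono) auto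
    finally show ?thesis .
  qed
  then show ?thesis
    using that[of "\<bar>b\<bar> + \<tau> * \<bar>r\<bar>"] \<tau>(1) by simp
qed

lemma norm_linear_le_sum_Basis:
  fixes f :: "'a::euclidean_space \<Rightarrow> 'b::real_normed_vector"
  assumes "linear f"
  shows "norm (f v) \<le> norm v * (\<Sum>i\<in>Basis. norm (f i))"
proof -
  have "f v = f (\<Sum>i\<in>Basis. (v \<bullet> i) *\<^sub>R i)"
    by (simp add: euclidean_representation)
  also have "\<dots> = (\<Sum>i\<in>Basis. (v \<bullet> i) *\<^sub>R f i)"
    using assms by (simp add: linear_sum linear_cmul)
  also have "norm \<dots> \<le> (\<Sum>i\<in>Basis. norm v * norm (f i))"
    by (intro sum_norm_le) (auto intro!: mult_right_mono Basis_le_norm)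
  finally show ?thesis
    by (simp add: sum_distrib_left)
qed

lemma C_k_Suc_has_derivative:
  assumes "C_k (Suc k) f"
  shows "(f has_derivative frechet_derivative f (at x)) (at x within S)"
  using assms by (simp add: frechet_derivative_works[symmetric] has_derivative_at_withinI)

lemma C_1_lipschitz_on_cball:
  fixes f :: "'a::euclidean_space \<Rightarrow> 'b::euclidean_space"
  assumes "C_k 1 f"
  obtains L where "L \<ge> 0"
    "\<And>x y. x \<in> cball 0 r \<Longrightarrow> y \<in> cball 0 r \<Longrightarrow> norm (f y - f x) \<le> L * norm (y - x)"
proof -
  have D: "(f has_derivative frechet_derivative f (at x)) (at x within S)" for x S
    using assms C_k_Suc_has_derivative[of 0 f] by simp
  have "continuous_on (cball 0 r) (\<lambda>x. frechet_derivative f (at x) i)" for i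
    using assms by (simp add: continuous_on_subset[OF _ subset_UNIV])
  then have "continuous_on (cball 0 r) (\<lambda>x. \<Sum>i\<in>Basis. norm (frechet_derivative f (at x) i))"
    by (intro continuous_intros)
  then have "compact ((\<lambda>x. \<Sum>i\<in>Basis. norm (frechet_derivative f (at x) i)) ` cball 0 r)"
    by (intro compact_continuous_image) auto
  then obtain L where L:
      "\<And>x. x \<in> cball 0 r \<Longrightarrow> \<bar>\<Sum>i\<in>Basis. norm (frechet_derivative f (at x) i)\<bar> \<le> L"
    using compact_imp_bounded by (fastforce simp: bounded_iff)
  have "onorm (frechet_derivative f (at x)) \<le> \<bar>L\<bar>" if "x \<in> cball 0 r" for x
  proof (rule onorm_le)
    fix v
    have "norm (frechet_derivative f (at x) v)
        \<le> norm v * (\<Sum>i\<in>Basis. norm (frechet_derivative f (at x) i))"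
      by (intro norm_linear_le_sum_Basis has_derivative_linear[OF D])
    also have "\<dots> \<le> norm v * \<bar>L\<bar>"
      using L[OF that] by (intro mult_left_mono) auto
    finally show "norm (frechet_derivative f (at x) v) \<le> \<bar>L\<bar> * norm v"
      by (simp add: mult.commute)
  qed
  then have "norm (f y - f x) \<le> \<bar>L\<bar> * norm (y - x)" if "x \<in> cball 0 r" "y \<in> cball 0 r" for x y
    using differentiable_bound[of "cball 0 r" f "\<lambda>x. frechet_derivative f (at x)" "\<bar>L\<bar>" y x] that D
    by simp
  then show ?thesis
    using that[of "\<bar>L\<bar>"] by simp
qed

text \<open>
  The derivative of a twice continuously differentiable map is Lipschitz on a ball. On the segment
  from \<open>x\<close> to \<open>y\<close> it thus differs from its value at \<open>x\<close> by at most a multiple of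
  \<open>norm (y - x)\<close>, and the mean value inequality supplies the second factor.
\<close>

lemma taylor_remainder_quadratic:
  fixes f :: "'a::euclidean_space \<Rightarrow> 'b::euclidean_space"
  assumes "C_k 2 f"
  obtains L where "L \<ge> 0"
    "\<And>x y. x \<in> cball 0 r \<Longrightarrow> y \<in> cball 0 r \<Longrightarrow>
       norm (f y - f x - frechet_derivative f (at x) (y - x)) \<le> L * (norm (y - x))\<^sup>2"
proof -
  let ?D = "\<lambda>x. frechet_derivative f (at x)"
  have D: "(f has_derivative ?D x) (at x within S)" for x S
    using assms C_k_Suc_has_derivative[of 1 f] by (simp add: numeral_2_eq_2)
  have "\<exists>L\<ge>0. \<forall>x\<in>cball 0 r. \<forall>y\<in>cball 0 r. norm (?D y i - ?D x i) \<le> L * norm (y - x)" for i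
    using assms C_1_lipschitz_on_cball[of "\<lambda>x. ?D x i" r] by (metis C_k.simps(2) One_nat_def Suc_1)
  then obtain L where L0: "\<And>i. L i \<ge> 0"
    and L: "\<And>i x y. x \<in> cball 0 r \<Longrightarrow> y \<in> cball 0 r \<Longrightarrow> norm (?D y i - ?D x i) \<le> L i * norm (y - x)"
    by metis
  define K where "K = (\<Sum>i\<in>Basis. L i)"
  have "K \<ge> 0"
    unfolding K_def using L0 by (intro sum_nonneg) auto
  moreover have "norm (f y - f x - ?D x (y - x)) \<le> K * (norm (y - x))\<^sup>2"
    if x: "x \<in> cball 0 r" and y: "y \<in> cball 0 r" for x y
  proof -
    have seg: "closed_segment x y \<subseteq> cball 0 r"
      using x y by (intro closed_segment_subset) auto
    have B: "onorm (?D z - ?D x) \<le> K * norm (y - x)" if z: "z \<in> closed_segment x y" for z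
    proof (rule onorm_le)
      fix v
      have "norm (?D z v - ?D x v) \<le> norm v * (\<Sum>i\<in>Basis. norm (?D z i - ?D x i))"
        by (intro norm_linear_le_sum_Basis linear_compose_sub has_derivative_linear[OF D])
      also have "\<dots> \<le> norm v * (\<Sum>i\<in>Basis. L i * norm (y - x))"
      proof (intro mult_left_mono sum_mono)
        fix i
        have "norm (?D z i - ?D x i) \<le> L i * norm (z - x)"
          using L seg z x by blast
        also have "\<dots> \<le> L i * norm (y - x)"
          using segment_bound1[OF z] L0 by (intro mult_left_mono) (auto simp: norm_minus_commute)
        finally show "norm (?D z i - ?D x i) \<le> L i * norm (y - x)" .
      qed simp
      finally show "norm ((?D z - ?D x) v) \<le> K * norm (y - x) * norm v"
        by (simp add: K_def sum_distrib_right mult_ac)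
    qed
    have "norm (f y - f x - ?D x (y - x)) \<le> norm (y - x) * (K * norm (y - x))"
    proof (rule differentiable_bound_linearization[OF _ D B])
      show "x + t *\<^sub>R (y - x) \<in> closed_segment x y" if "t \<in> {0..1}" for t
        using that by (auto simp: closed_segment_def algebra_simps intro!: exI[of _ t])
    qed auto
    then show ?thesis
      by (simp add: power2_eq_square mult_ac)
  qed
  ultimately show ?thesis
    using that by blast
qed

text \<open>
  Surjectivity of the derivative makes its adjoint injective, so \<open>norm (A\<^sup>T w)\<close> is positive
  on the compact product of \<open>K\<close> with the unit sphere, where it attains its minimum.
\<close>

lemma adjoint_derivative_bounded_below:
  fixes f :: "'a::euclidean_space \<Rightarrow> 'b::euclidean_space"
  assumes "C_k 1 f" "compact K" "\<And>x. x \<in> K \<Longrightarrow> surj (frechet_derivative f (at x))"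
  obtains m where "m > 0"
    "\<And>x w. x \<in> K \<Longrightarrow> m * norm w \<le> norm (adjoint (frechet_derivative f (at x)) w)"
proof (cases "K = {}")
  case True
  then show ?thesis
    using that[of 1] by simp
next
  case False
  let ?A = "\<lambda>x. adjoint (frechet_derivative f (at x))"
  have lin: "linear (frechet_derivative f (at x))" for x
    using assms(1) has_derivative_linear[OF C_k_Suc_has_derivative[of 0 f]] by simp
  \<comment> \<open>In coordinates the adjoint only involves the partial derivatives of \<open>f\<close>, which are continuous.\<close>
  have coord: "?A x w = (\<Sum>i\<in>Basis. (w \<bullet> frechet_derivative f (at x) i) *\<^sub>R i)" for x w
    by (subst euclidean_representation[symmetric, of "?A x w"]) (simp add: adjoint_clauses(2)[OF lin])
  have "continuous_on (K \<times> sphere 0 1) (\<lambda>p. norm (?A (fst p) (snd p)))"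
  proof -
    have "continuous_on UNIV (\<lambda>x. frechet_derivative f (at x) i)" for i
      using assms(1) by simp
    then have "continuous_on (K \<times> sphere 0 1) (\<lambda>p. frechet_derivative f (at (fst p)) i)" for i
      by (rule continuous_on_compose2) (auto intro: continuous_intros)
    then show ?thesis
      unfolding coord by (intro continuous_intros)
  qed
  moreover have "compact (K \<times> sphere 0 1 :: ('a \<times> 'b) set)" "K \<times> sphere 0 1 \<noteq> ({} :: ('a \<times> 'b) set)"
    using assms(2) False by (auto intro: compact_Times)
  ultimately obtain p where p: "p \<in> K \<times> sphere 0 1"
    and min: "\<And>q. q \<in> K \<times> sphere 0 1 \<Longrightarrow> norm (?A (fst p) (snd p)) \<le> norm (?A (fst q) (snd q))"
    using continuous_attains_inf[of "K \<times> sphere 0 1" "\<lambda>p. norm (?A (fst p) (snd p))"] by blast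
  define m where "m = norm (?A (fst p) (snd p))"
  have "m \<noteq> 0"
  proof
    assume "m = 0"
    have "surj (frechet_derivative f (at (fst p)))"
      using p by (intro assms(3)) auto
    then obtain v where "snd p = frechet_derivative f (at (fst p)) v"
      by (rule surjE)
    then have "snd p \<bullet> snd p = ?A (fst p) (snd p) \<bullet> v"
      by (simp add: adjoint_clauses(2)[OF lin])
    then show False
      using \<open>m = 0\<close> p by (auto simp: m_def)
  qed
  then have "m > 0"
    by (simp add: m_def)
  moreover have "m * norm w \<le> norm (?A x w)" if x: "x \<in> K" for x w
  proof (cases "w = 0")
    case False
    have "m \<le> norm (?A x (sgn w))"
      using min[of "(x, sgn w)"] x False by (simp add: m_def norm_sgn)
    also have "\<dots> = norm (?A x w) / norm w"
      by (simp add: sgn_div_norm linear_cmul[OF adjoint_linear[OF lin]] divide_inverse mult.commute)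
    finally show ?thesis
      using False by (simp add: pos_le_divide_eq)
  qed simp
  ultimately show ?thesis
    using that by blast
qed

text \<open>
  For \<open>A\<close> the derivative of a defining map of a manifold, this parametrizes the normal space.
\<close>

lemma orthogonal_comp_kernel_eq_range_adjoint:
  fixes A :: "'a::euclidean_space \<Rightarrow> 'b::euclidean_space"
  assumes "linear A"
  shows "{v. A v = 0}\<^sup>\<bottom> = range (adjoint A)"
proof -
  have "{v. A v = 0} = (range (adjoint A))\<^sup>\<bottom>"
    using ker_orthogonal_comp_adjoint[OF assms] by (auto simp: vimage_def)
  then show ?thesis
    by (simp add: orthogonal_comp_self linear_subspace_image adjoint_linear assms)
qed

theorem corollary1:
  fixes F :: "real ^ 'p \<Rightarrow> real ^ 'q" and M :: "(real ^ 'p) set" and h :: "real ^ 'p \<Rightarrow> real"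
  assumes "smooth F"
    and "M = {X. F X = 0}"
    and "compact M"
    and "\<And>X. X \<in> M \<Longrightarrow> rank (jacobian F (at X)) = CARD('q)"
    and "weakly_convex h"
  shows "\<exists>c>0. \<forall>X\<in>M. \<forall>Y\<in>M. \<forall>G\<in>riemannian_subdifferential F h X.
           h Y \<ge> h X + G \<bullet> (Y - X) - c * (norm (Y - X))\<^sup>2"
proof -
  let ?D = "\<lambda>X. frechet_derivative F (at X)"
  have C: "C_k k F" for k
    using assms(1) by (simp add: smooth_def)
  have lin: "linear (?D X)" for X
    using has_derivative_linear[OF C_k_Suc_has_derivative[OF C]] .
  have surj: "surj (?D X)" if "X \<in> M" for X
  proof -
    have "surj ((*v) (jacobian F (at X)))"
      using assms(4)[OF that] by (simp add: full_rank_surjective)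
    then show ?thesis
      unfolding jacobian_def matrix_vector_mul(2)[OF lin] .
  qed
  obtain \<tau> where \<tau>: "0 \<le> \<tau>" "convex_on UNIV (shifted \<tau> h)"
    using assms(5) unfolding weakly_convex_def by blast
  obtain B where B: "B \<ge> 0" "\<And>X v. X \<in> M \<Longrightarrow> v \<in> subdifferential h X \<Longrightarrow> norm v \<le> B"
    using subdifferential_bounded_on_compact[OF assms(5,3)] by blast
  obtain m where m: "m > 0" "\<And>X w. X \<in> M \<Longrightarrow> m * norm w \<le> norm (adjoint (?D X) w)"
    using adjoint_derivative_bounded_below[OF C assms(3) surj] by blast
  obtain r where r: "\<And>X. X \<in> M \<Longrightarrow> X \<in> cball 0 r"
    using assms(3) by (metis bounded_iff compact_imp_bounded mem_cball_0)
  obtain L where L: "L \<ge> 0" "\<And>X Y. X \<in> cball 0 r \<Longrightarrow> Y \<in> cball 0 r \<Longrightarrow>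
      norm (F Y - F X - ?D X (Y - X)) \<le> L * (norm (Y - X))\<^sup>2"
    using taylor_remainder_quadratic[OF C] by blast
  define c where "c = \<tau> / 2 + B / m * L"
  have "h Y \<ge> h X + G \<bullet> (Y - X) - c * (norm (Y - X))\<^sup>2"
    if X: "X \<in> M" and Y: "Y \<in> M" and G: "G \<in> riemannian_subdifferential F h X" for X Y G
  proof -
    obtain v where v: "v \<in> subdifferential h X"
      and Gv: "G = orthogonal_projector (tangent_space F X) v"
      using G unfolding riemannian_subdifferential_def by blast
    have "subspace (tangent_space F X)"
      unfolding tangent_space_def by (rule linear_subspace_kernel[OF lin])
    note proj = orthogonal_projector[OF this, of v, folded Gv]
    obtain w where w: "v - G = adjoint (?D X) w"
      using proj(2) orthogonal_comp_kernel_eq_range_adjoint[OF lin[of X]]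
      by (auto simp: tangent_space_def)
    have "norm (v - G) \<le> norm v"
    proof -
      have "orthogonal G (v - G)"
        using proj by (auto simp: orthogonal_comp_def)
      then have "(norm v)\<^sup>2 = (norm G)\<^sup>2 + (norm (v - G))\<^sup>2"
        using norm_add_Pythagorean[of G "v - G"] by simp
      then show ?thesis
        by (simp add: power2_le_imp_le)
    qed
    then have "m * norm w \<le> B"
      using m(2)[OF X, of w] B(2)[OF X v] w by simp
    then have wB: "norm w \<le> B / m"
      using m(1) by (simp add: pos_le_divide_eq mult.commute)
    have DL: "norm (?D X (Y - X)) \<le> L * (norm (Y - X))\<^sup>2"
      using L(2)[OF r[OF X] r[OF Y]] X Y assms(2) by simp
    have "(v - G) \<bullet> (Y - X) = w \<bullet> ?D X (Y - X)"
      by (simp add: w adjoint_clauses(2)[OF lin])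
    moreover have "\<bar>w \<bullet> ?D X (Y - X)\<bar> \<le> norm w * norm (?D X (Y - X))"
      by (rule Cauchy_Schwarz_ineq2)
    moreover have "norm w * norm (?D X (Y - X)) \<le> B / m * (L * (norm (Y - X))\<^sup>2)"
      using wB DL B(1) m(1) by (intro mult_mono) auto
    ultimately have "(v - G) \<bullet> (Y - X) \<ge> - (B / m * L * (norm (Y - X))\<^sup>2)"
      by (simp only: mult.assoc)
    moreover have "h Y \<ge> h X + v \<bullet> (Y - X) - \<tau> / 2 * (norm (Y - X))\<^sup>2"
      by (rule weakly_convex_subgradient_inequality[OF \<tau> v])
    ultimately show ?thesis
      by (simp add: c_def inner_diff_left algebra_simps)
  qed
  moreover have "c \<ge> 0"
    using \<tau>(1) B(1) m(1) L(1) by (simp add: c_def)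
  \<comment> \<open>\<open>c\<close> may vanish, for instance when \<open>\<tau>\<close> and \<open>B\<close> are 0; adding 1 makes it positive.\<close>
  moreover have "c * (norm Z)\<^sup>2 \<le> (c + 1) * (norm Z)\<^sup>2" for Z :: "real ^ 'p"
    by (intro mult_right_mono) auto
  ultimately show ?thesis
    by (intro exI[of _ "c + 1"]) (smt (verit, best))
qed

end
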